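(* Let $t>3$ be an odd integer and let $S=(1,2,2,2,\ldots)$, i.e. $a_1=1$ and $a_i=2$ for all $i\ge 2$. Then $\chi_S(G_t)=5$.
   Context: For an odd integer $t\ge 3$, $G_t$ denotes the integer distance graph $G(\mathbb{Z},\{2,t\})$: its vertex set is $\mathbb{Z}$, and distinct $i,j\in\mathbb{Z}$ are adjacent if and only if $|i-j|\in\{2,t\}$. For a graph $G$ and a non-decreasing sequence $S=(a_1,a_2,\ldots)$ of positive integers, an $S$-packing $k$-coloring of $G$ is a map $f:V(G)\to\{1,\ldots,k\}$ such that any two distinct vertices $u,v$ with $f(u)=f(v)=i$ satisfy $d_G(u,v)>a_i$, where $d_G$ is the shortest-path distance. The $S$-packing chromatic number $\chi_S(G)$ is the smallest $k$ for which $G$ has an $S$-packing $k$-coloring. *)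

theory Defs
  imports "Graph_Theory.Pair_Digraph" "Graph_Theory.Shortest_Path" "HOL-Library.Extended_Nat"
begin

text \<open>An undirected graph is a loop-free symmetric digraph without parallel arcs.\<close>

definition integer_distance_graph :: "int set \<Rightarrow> int pair_pre_digraph" where
  "integer_distance_graph D =
     \<lparr> pverts = UNIV, parcs = {(i, j). i \<noteq> j \<and> \<bar>i - j\<bar> \<in> D} \<rparr>"

lemma pair_bidirected_digraph_integer_distance_graph:
  "pair_bidirected_digraph (integer_distance_graph D)"
  by unfold_locales
    (auto simp: integer_distance_graph_def symmetric_def abs_minus_commute intro!: symI)

text \<open>With unit arc weights, the cost of a walk is its length; the distance between vertices in
  different components is \<open>\<infinity>\<close>.\<close>

definition gdist :: "'a pair_pre_digraph \<Rightarrow> 'a \<Rightarrow> 'a \<Rightarrow> ereal" where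
  "gdist G u v = wf_digraph.\<mu> (with_proj G) (\<lambda>_. 1) u v"

text \<open>The sequence \<open>S\<close> is indexed from \<open>1\<close>; the value \<open>S 0\<close> is never used.\<close>

definition S_packing_coloring ::
    "(nat \<Rightarrow> nat) \<Rightarrow> nat \<Rightarrow> 'a pair_pre_digraph \<Rightarrow> ('a \<Rightarrow> nat) \<Rightarrow> bool" where
  "S_packing_coloring S k G f \<longleftrightarrow>
     (\<forall>v \<in> pverts G. f v \<in> {1..k}) \<and>
     (\<forall>i \<in> {1..k}. \<forall>u \<in> pverts G. \<forall>v \<in> pverts G.
        u \<noteq> v \<and> f u = i \<and> f v = i \<longrightarrow> gdist G u v > ereal (real (S i)))"

text \<open>An infimum in \<open>enat\<close> over a nonempty set is attained; the value is \<open>\<infinity>\<close> if no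
  finite number of colors suffices.\<close>

definition S_packing_chromatic_number ::
    "(nat \<Rightarrow> nat) \<Rightarrow> 'a pair_pre_digraph \<Rightarrow> enat" where
  "S_packing_chromatic_number S G = (INF k \<in> {k. \<exists>f. S_packing_coloring S k G f}. enat k)"

end

theory Submission
  imports Defs
begin

text \<open>
  Lower bound: the four neighbours of a vertex are pairwise at distance at most \<open>2\<close>. The
  neighbours of a vertex of color \<open>1\<close> avoid color \<open>1\<close>, so they need four further colors; if
  color \<open>1\<close> is not used, the neighbours of any vertex need four colors other than \<open>1\<close>.

  Upper bound: in a cyclic word over \<open>{1..5}\<close> composed of the blocks \<open>23145\<close> and \<open>231451\<close>, equal
  letters are more than \<open>2\<close> apart, and more than \<open>4\<close> apart unless the letter is \<open>1\<close>. If \<open>2\<close>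
  and \<open>t\<close>, multiplied by some \<open>m\<close>, become \<open>\<plusminus>1\<close> and \<open>\<plusminus>2\<close> (in either order) modulo the length \<open>N\<close>
  of the word, then coloring \<open>v\<close> with the letter at position \<open>m v mod N\<close> is as required. For
  odd \<open>N = t \<plusminus> 4\<close> the inverse \<open>m\<close> of \<open>2\<close> modulo \<open>N\<close> does this, and one of the two values of \<open>N\<close>
  is of the form \<open>5 a + 6 b\<close> unless \<open>t = 5\<close>; there \<open>N = 6\<close> and \<open>m = 1\<close> work.
\<close>

section \<open>Distances at most 1 and 2 in terms of arcs\<close>

text \<open>Walk lengths are integers: if every walk from \<open>u\<close> to \<open>v\<close> is
  longer than \<open>n\<close>, the infimum defining the distance is at least \<open>n + 1\<close>.
  Without any walk it is infinite.\<close>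

lemma gdist_le_iff_awalk:
  assumes "pair_wf_digraph G"
  shows "gdist G u v \<le> ereal (real n) \<longleftrightarrow>
    (\<exists>p. pre_digraph.awalk (with_proj G) u p v \<and> length p \<le> n)"
proof -
  interpret pair_wf_digraph G by fact
  have cost: "awalk_cost (\<lambda>_. 1) p = real (length p)" for p :: "('a \<times> 'a) list"
    by (induction p) auto
  show ?thesis
  proof
    assume le: "gdist G u v \<le> ereal (real n)"
    show "\<exists>p. awalk u p v \<and> length p \<le> n"
    proof (rule ccontr)
      assume "\<not> ?thesis"
      then have "\<mu> (\<lambda>_. 1) u v \<ge> ereal (real (Suc n))"
        unfolding \<mu>_def cost by (intro INF_greatest) (force simp: not_le)
      with le have "ereal (real (Suc n)) \<le> ereal (real n)"
        unfolding gdist_def by (rule order_trans[rotated])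
      then show False by simp
    qed
  next
    assume "\<exists>p. awalk u p v \<and> length p \<le> n"
    then obtain p where p: "awalk u p v" "length p \<le> n" by blast
    from p(1) have "\<mu> (\<lambda>_. 1) u v \<le> ereal (awalk_cost (\<lambda>_. 1) p)"
      by (rule min_cost_le_walk_cost)
    also have "\<dots> \<le> ereal (real n)" using p(2) by (simp add: cost)
    finally show "gdist G u v \<le> ereal (real n)" unfolding gdist_def .
  qed
qed

lemma gdist_le_1_iff:
  assumes "pair_wf_digraph G" "u \<in> pverts G" "u \<noteq> v"
  shows "gdist G u v \<le> ereal 1 \<longleftrightarrow> (u, v) \<in> parcs G"
proof -
  interpret pair_wf_digraph G by fact
  have "awalk u p v \<and> length p \<le> 1 \<longleftrightarrow> p = [(u, v)] \<and> (u, v) \<in> parcs G" for p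
    using assms(2,3) by (cases p) (auto simp: awalk_Nil_iff awalk_Cons_iff dest: in_arcsD2)
  then show ?thesis using gdist_le_iff_awalk[OF assms(1), of u v 1] by simp
qed

lemma gdist_le_2_iff:
  assumes "pair_wf_digraph G" "u \<in> pverts G" "u \<noteq> v"
  shows "gdist G u v \<le> ereal 2 \<longleftrightarrow>
    (u, v) \<in> parcs G \<or> (\<exists>w. (u, w) \<in> parcs G \<and> (w, v) \<in> parcs G)"
proof -
  interpret pair_wf_digraph G by fact
  have "awalk u p v \<and> length p \<le> 2 \<longleftrightarrow>
    p = [(u, v)] \<and> (u, v) \<in> parcs G \<or>
    (\<exists>w. p = [(u, w), (w, v)] \<and> (u, w) \<in> parcs G \<and> (w, v) \<in> parcs G)" for p
    using assms(2,3)
    \<comment> \<open>The rule serves only as a case split of \<open>p\<close> into no, one, or at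
      least two arcs.\<close>
    by (cases p rule: remdups_adj.cases)
      (auto simp: awalk_Nil_iff awalk_Cons_iff dest: in_arcsD2)
  then show ?thesis using gdist_le_iff_awalk[OF assms(1), of u v 2] by auto
qed

lemma pair_wf_digraph_integer_distance_graph: "pair_wf_digraph (integer_distance_graph D)"
proof -
  interpret pair_bidirected_digraph "integer_distance_graph D"
    by (rule pair_bidirected_digraph_integer_distance_graph)
  show ?thesis by unfold_locales
qed

lemma pverts_integer_distance_graph [simp]: "pverts (integer_distance_graph D) = UNIV"
  by (simp add: integer_distance_graph_def)

lemma parcs_integer_distance_graph_2_t:
  assumes "t > 0"
  shows "(u, v) \<in> parcs (integer_distance_graph {2, t}) \<longleftrightarrow> v - u \<in> {2, -2, t, -t}"
  using assms by (auto simp: integer_distance_graph_def abs_if)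

section \<open>The lower bound\<close>

lemma S_packing_coloring_ge_5:
  fixes t :: int
  assumes t: "odd t" "t > 0" and S: "S 1 = 1" "\<And>i. i \<ge> 2 \<Longrightarrow> S i = 2"
    and f: "S_packing_coloring S k (integer_distance_graph {2, t}) f"
  shows "k \<ge> 5"
proof (rule ccontr)
  assume k: "\<not> k \<ge> 5"
  note wf = pair_wf_digraph_integer_distance_graph[of "{2, t}"]
  note adj = parcs_integer_distance_graph_2_t[OF t(2)]
  have range: "f v \<in> {1..k}" for v
    using f by (simp add: S_packing_coloring_def)
  have far: "\<not> gdist (integer_distance_graph {2, t}) u v \<le> ereal (real (S (f u)))"
    if "u \<noteq> v" "f u = f v" for u v
    using f that range unfolding S_packing_coloring_def not_le by auto
  have one: "f v \<noteq> 1" if "f u = 1" "v - u \<in> {2, -2, t, -t}" for u v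
    using far[of u v] that t(2) S(1) gdist_le_1_iff[OF wf, of u v] unfolding adj by auto
  \<comment> \<open>A vertex of color 1 serves by \<open>one\<close>; if there is none, every vertex
    serves.\<close>
  obtain u where u: "\<And>v. v - u \<in> {2, -2, t, -t} \<Longrightarrow> f v \<noteq> 1"
    using one by metis
  define A where "A = {u + 2, u - 2, u + t, u - t}"
  have A: "v - u \<in> {2, -2, t, -t}" if "v \<in> A" for v
    using that by (auto simp: A_def)
  have A': "u - v \<in> {2, -2, t, -t}" if "v \<in> A" for v
    using that by (auto simp: A_def)
  have f_A: "f v \<in> {2..k}" if "v \<in> A" for v
    using u[OF A[OF that]] range[of v] by auto
  have "inj_on f A"
  proof (rule inj_onI, rule ccontr)
    fix v w assume vw: "v \<in> A" "w \<in> A" "f v = f w" "v \<noteq> w"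
    have "S (f v) = 2" using f_A[OF vw(1)] S(2) by simp
    moreover have "gdist (integer_distance_graph {2, t}) v w \<le> ereal 2"
      using gdist_le_2_iff[OF wf, of v w] A'[OF vw(1)] A[OF vw(2)] vw(4) unfolding adj by auto
    ultimately show False using far[OF vw(4,3)] by simp
  qed
  then have "card A \<le> card {2..k}"
    using f_A by (intro card_inj_on_le[of f]) auto
  \<comment> \<open>For \<open>t = 2\<close> the four neighbours would collapse to two; oddness
    excludes this.\<close>
  moreover have "t \<noteq> 2" using t(1) by auto
  then have "card A = 4" using t(2) by (simp add: A_def)
  ultimately show False using k by simp
qed

section \<open>The periodic word and its windows\<close>

text \<open>The word \<open>(23145)\<^sup>a(231451)\<^sup>b\<close>, repeated periodically.\<close>

definition block_word :: "int \<Rightarrow> int \<Rightarrow> int \<Rightarrow> nat" where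
  "block_word a b j = (let r = j mod (5 * a + 6 * b) in
     [2, 3, 1, 4, 5, 1] ! nat (if r < 5 * a then r mod 5 else (r - 5 * a) mod 6))"

lemma block_word_periodic: "block_word a b (j + k * (5 * a + 6 * b)) = block_word a b j"
  by (simp add: block_word_def)

text \<open>Since \<open>e\<close> is at most 4, a move from index \<open>s\<close> of a short block
  ends in that block or at index \<open>s + e - 5\<close>, at most 3, of the next one. Such an index
  exists in both kinds of block, so the kind of the next block is irrelevant.\<close>

lemma block_index_5:
  fixes a b :: int
  assumes "a \<ge> 0" "b \<ge> 0" and r: "0 \<le> r" "r < 5 * a" and e: "0 \<le> e" "e \<le> 4"
    and N: "N = 5 * a + 6 * b" and s: "s = r mod 5"
    and q: "q = (if r + e < N then r + e else r + e - N)"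
  shows "(if q < 5 * a then q mod 5 else (q - 5 * a) mod 6)
          = (if s + e < 5 then s + e else s + e - 5)"
proof -
  define k where "k = r div 5"
  have rk: "r = 5 * k + s" "0 \<le> s" "s < 5" using s by (auto simp: k_def)
  have k: "k \<le> a - 1" using r rk by linarith
  show ?thesis
  proof (cases "s + e < 5")
    case True
    then have "q = 5 * k + (s + e)" "q < 5 * a" using q rk k N assms(2) by auto
    then show ?thesis using True rk e by simp
  next
    case False
    have wrap: "(s + e) mod 5 = s + e - 5"
      using mod_pos_pos_trivial[of "s + e - 5" 5] False rk e by simp
    \<comment> \<open>The next block is short, or is the first block of the word again, or is the
      first long block.\<close>
    consider "k < a - 1" | "k = a - 1" "b = 0" | "k = a - 1" "b \<ge> 1"
      using k assms(2) by linarith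
    then show ?thesis
    proof cases
      case 1
      then have "q = 5 * (k + 1) + (s + e - 5)" "q < 5 * a" using q rk k N assms(2) e by auto
      then show ?thesis using wrap False by simp
    next
      case 2
      then have "q = s + e - 5" using q rk k N False e by auto
      then show ?thesis using wrap False rk e k r by simp
    next
      case 3
      then have "q = 5 * a + (s + e - 5)" using q rk k N False e by auto
      then show ?thesis using wrap False rk e k r by simp
    qed
  qed
qed

text \<open>As for short blocks: a move that leaves the block ends at index
  \<open>s + e - 6\<close>, at most 3, of the next one.\<close>

lemma block_index_6:
  fixes a b :: int
  assumes "a \<ge> 0" "b \<ge> 0" and r: "5 * a \<le> r" "r < N" and e: "0 \<le> e" "e \<le> 4"
    and N: "N = 5 * a + 6 * b" and s: "s = (r - 5 * a) mod 6"
    and q: "q = (if r + e < N then r + e else r + e - N)"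
  shows "(if q < 5 * a then q mod 5 else (q - 5 * a) mod 6)
          = (if s + e < 6 then s + e else s + e - 6)"
proof -
  define k where "k = (r - 5 * a) div 6"
  have rk: "r = 5 * a + 6 * k + s" "0 \<le> s" "s < 6" using s
    by (auto simp: k_def algebra_simps minus_mod_eq_mult_div [symmetric])
  have k: "k \<le> b - 1" "0 \<le> k" using r rk N by linarith+
  show ?thesis
  proof (cases "s + e < 6")
    case True
    then have "q = 5 * a + (6 * k + (s + e))" using q rk k N by auto
    then show ?thesis using True rk e k by simp
  next
    case False
    have wrap: "(s + e) mod 6 = s + e - 6"
      using mod_pos_pos_trivial[of "s + e - 6" 6] False rk e by simp
    consider "k < b - 1" | "k = b - 1" using k by linarith
    then show ?thesis
    proof cases
      case 1
      then have "q = 5 * a + (6 * (k + 1) + (s + e - 6))" using q rk k N e by auto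
      then show ?thesis using wrap False rk e k by simp
    next
      case 2
      then have "q = s + e - 6" using q rk k N False e by auto
      \<comment> \<open>After the last long block the word restarts, with a long block exactly when
        \<open>a = 0\<close>.\<close>
      then show ?thesis using wrap False rk e assms(1) by (cases "a = 0") auto
    qed
  qed
qed

text \<open>Both blocks start with \<open>2314\<close>, so a window of length \<open>5\<close> depends only on the block in which
  it starts.\<close>

lemma block_word_window:
  assumes "a \<ge> 0" "b \<ge> 0" "a + b > 0"
  obtains s where "s \<in> {0..4}"
      "\<And>e. e \<in> {0..4} \<Longrightarrow> block_word a b (j + e) = [2, 3, 1, 4, 5, 2, 3, 1, 4] ! nat (s + e)"
    | s where "s \<in> {0..5}"
      "\<And>e. e \<in> {0..4} \<Longrightarrow> block_word a b (j + e) = [2, 3, 1, 4, 5, 1, 2, 3, 1, 4] ! nat (s + e)"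
proof -
  define N where "N = 5 * a + 6 * b"
  define r where "r = j mod N"
  \<comment> \<open>Hence \<open>e < N\<close>, and \<open>r + e\<close> passes the end of the word
    at most once.\<close>
  have N: "N \<ge> 5" using assms by (simp add: N_def)
  have r: "0 \<le> r" "r < N" using N by (auto simp: r_def)
  have mod_N: "(j + e) mod N = (if r + e < N then r + e else r + e - N)" if "e \<in> {0..4}" for e
  proof -
    have "(j + e) mod N = (r + e) mod N" by (simp add: r_def mod_simps)
    also have "\<dots> = (if r + e < N then r + e else r + e - N)"
      using that r N mod_pos_pos_trivial[of "r + e - N" N] by auto
    finally show ?thesis .
  qed
  have word: "block_word a b i = [2, 3, 1, 4, 5, 1] !
      nat (if i mod N < 5 * a then i mod N mod 5 else (i mod N - 5 * a) mod 6)" for i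
    by (simp add: block_word_def N_def Let_def)
  show thesis
  proof (cases "r < 5 * a")
    case True
    define s where "s = r mod 5"
    have s: "s \<in> {0..4}" by (auto simp: s_def)
    have "block_word a b (j + e) = [2, 3, 1, 4, 5, 2, 3, 1, 4] ! nat (s + e)"
      if e: "e \<in> {0..4}" for e
    proof -
      have "(if (j + e) mod N < 5 * a then (j + e) mod N mod 5 else ((j + e) mod N - 5 * a) mod 6)
          = (if s + e < 5 then s + e else s + e - 5)"
        using block_index_5[OF assms(1,2) r(1) True _ _ N_def s_def mod_N[OF e]] e by simp
      then have "block_word a b (j + e) =
          [2, 3, 1, 4, 5, 1] ! nat (if s + e < 5 then s + e else s + e - 5)"
        unfolding word by (rule arg_cong)
      moreover have "s = 0 \<or> s = 1 \<or> s = 2 \<or> s = 3 \<or> s = 4"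
        "e = 0 \<or> e = 1 \<or> e = 2 \<or> e = 3 \<or> e = 4"
        using s e by auto
      ultimately show ?thesis by (elim disjE) simp_all
    qed
    with s show ?thesis by (rule that(1))
  next
    case False
    define s where "s = (r - 5 * a) mod 6"
    have s: "s \<in> {0..5}" by (auto simp: s_def)
    have "block_word a b (j + e) = [2, 3, 1, 4, 5, 1, 2, 3, 1, 4] ! nat (s + e)"
      if e: "e \<in> {0..4}" for e
    proof -
      have "(if (j + e) mod N < 5 * a then (j + e) mod N mod 5 else ((j + e) mod N - 5 * a) mod 6)
          = (if s + e < 6 then s + e else s + e - 6)"
        using block_index_6[OF assms(1,2) _ r(2) _ _ N_def s_def mod_N[OF e]] False e by simp
      then have "block_word a b (j + e) =
          [2, 3, 1, 4, 5, 1] ! nat (if s + e < 6 then s + e else s + e - 6)"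
        unfolding word by (rule arg_cong)
      moreover have "s = 0 \<or> s = 1 \<or> s = 2 \<or> s = 3 \<or> s = 4 \<or> s = 5"
        "e = 0 \<or> e = 1 \<or> e = 2 \<or> e = 3 \<or> e = 4"
        using s e by auto
      ultimately show ?thesis by (elim disjE) simp_all
    qed
    with s show ?thesis by (rule that(2))
  qed
qed

text \<open>A window shows the letter at \<open>j\<close> and the next four, so it suffices to
  inspect the five windows starting in a short block and the six starting in a long one.\<close>

lemma block_word_separated:
  assumes "a \<ge> 0" "b \<ge> 0" "a + b > 0"
  shows "block_word a b j \<in> {1..5}"
    and "e \<in> {1, 2} \<Longrightarrow> block_word a b (j + e) \<noteq> block_word a b j"
    and "e \<in> {1..4} \<Longrightarrow> block_word a b j \<noteq> 1 \<Longrightarrow> block_word a b (j + e) \<noteq> block_word a b j"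
proof -
  have "block_word a b j \<in> {1..5} \<and>
    (\<forall>e \<in> {1, 2}. block_word a b (j + e) \<noteq> block_word a b j) \<and>
    (\<forall>e \<in> {1, 2, 3, 4}. block_word a b j \<noteq> 1 \<longrightarrow> block_word a b (j + e) \<noteq> block_word a b j)"
    (is ?P)
  proof (rule block_word_window[OF assms, of j])
    fix s :: int
    assume s: "s \<in> {0..4}" and w: "\<And>e. e \<in> {0..4} \<Longrightarrow>
      block_word a b (j + e) = [2, 3, 1, 4, 5, 2, 3, 1, 4] ! nat (s + e)"
    have "s = 0 \<or> s = 1 \<or> s = 2 \<or> s = 3 \<or> s = 4" using s by auto
    then show ?P using w[of 0] w[of 1] w[of 2] w[of 3] w[of 4] by (elim disjE) simp_all
  next
    fix s :: int
    assume s: "s \<in> {0..5}" and w: "\<And>e. e \<in> {0..4} \<Longrightarrow>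
      block_word a b (j + e) = [2, 3, 1, 4, 5, 1, 2, 3, 1, 4] ! nat (s + e)"
    have "s = 0 \<or> s = 1 \<or> s = 2 \<or> s = 3 \<or> s = 4 \<or> s = 5" using s by auto
    then show ?P using w[of 0] w[of 1] w[of 2] w[of 3] w[of 4] by (elim disjE) simp_all
  qed
  moreover have "e \<in> {1, 2, 3, 4}" if "e \<in> {1..4}" using that by auto
  ultimately show "block_word a b j \<in> {1..5}"
    and "e \<in> {1, 2} \<Longrightarrow> block_word a b (j + e) \<noteq> block_word a b j"
    and "e \<in> {1..4} \<Longrightarrow> block_word a b j \<noteq> 1 \<Longrightarrow> block_word a b (j + e) \<noteq> block_word a b j"
    by blast+
qed

section \<open>Coloring by multiples modulo the length of the word\<close>

lemma S_packing_coloring_block_word: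
  fixes t m x y k l a b N :: int
  assumes t: "t > 0" and S: "S 1 = 1" "\<And>i. i \<ge> 2 \<Longrightarrow> S i = 2"
    and ab: "a \<ge> 0" "b \<ge> 0" "a + b > 0"
    and N: "N = 5 * a + 6 * b" and m: "m * 2 = x + k * N" "m * t = y + l * N"
    and xy: "\<bar>x\<bar> = 1 \<and> \<bar>y\<bar> = 2 \<or> \<bar>x\<bar> = 2 \<and> \<bar>y\<bar> = 1"
  shows "S_packing_coloring S 5 (integer_distance_graph {2, t}) (\<lambda>v. block_word a b (m * v))"
proof -
  define P where "P = block_word a b"
  note wf = pair_wf_digraph_integer_distance_graph[of "{2, t}"]
  note adj = parcs_integer_distance_graph_2_t[OF t]
  note sep = block_word_separated[OF ab, folded P_def]
  have per: "P (j + n * N) = P j" for j n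
    unfolding P_def N by (rule block_word_periodic)
  \<comment> \<open>A negative offset is reversed by starting at \<open>j + e\<close>. In
    \<open>far\<close>, if the letter there is 1, it differs from \<open>P j\<close> anyway.\<close>
  have near: "P (j + e) \<noteq> P j" if "\<bar>e\<bar> \<in> {1, 2}" for j e
    using sep(2)[of e j] sep(2)[of "-e" "j + e"] that by (auto simp: abs_if split: if_splits)
  have far: "P (j + e) \<noteq> P j" if "P j \<noteq> 1" "\<bar>e\<bar> \<in> {1..4}" for j e
    using sep(3)[of e j] sep(3)[of "-e" "j + e"] that by (auto simp: abs_if split: if_splits)
  \<comment> \<open>Recording which \<open>d\<close> yields which \<open>e\<close> lets
    \<open>two_arcs\<close> recognize a walk that turns back.\<close>
  have step: "\<exists>e n. m * d = e + n * N \<and> e \<in> {x, -x, y, -y} \<and>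
      (d = 2 \<and> e = x \<or> d = -2 \<and> e = -x \<or> d = t \<and> e = y \<or> d = -t \<and> e = -y)"
    if d: "d \<in> {2, -2, t, -t}" for d
  proof -
    have "m * (-2) = -x + (-k) * N" "m * (-t) = -y + (-l) * N" using m by simp_all
    with m d show ?thesis by blast
  qed
  have arc: "P (m * v) \<noteq> P (m * u)" if uv: "v - u \<in> {2, -2, t, -t}" for u v
  proof -
    obtain e n where e: "m * (v - u) = e + n * N" "e \<in> {x, -x, y, -y}"
      using step[OF uv] by blast
    have "m * v = m * u + e + n * N" using e(1) by (simp add: algebra_simps)
    then have "P (m * v) = P (m * u + e)" by (simp add: per)
    then show ?thesis using near[of e "m * u"] e(2) xy by auto
  qed
  have two_arcs: "P (m * v) \<noteq> P (m * u)"
    if uw: "w - u \<in> {2, -2, t, -t}" and wv: "v - w \<in> {2, -2, t, -t}"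
      and "u \<noteq> v" and one: "P (m * u) \<noteq> 1" for u v w
  proof -
    obtain e n where e: "m * (w - u) = e + n * N"
      "w - u = 2 \<and> e = x \<or> w - u = -2 \<and> e = -x \<or> w - u = t \<and> e = y \<or> w - u = -t \<and> e = -y"
      using step[OF uw] by blast
    obtain e' n' where e': "m * (v - w) = e' + n' * N"
      "v - w = 2 \<and> e' = x \<or> v - w = -2 \<and> e' = -x \<or> v - w = t \<and> e' = y \<or> v - w = -t \<and> e' = -y"
      using step[OF wv] by blast
    have "m * v = m * u + (e + e') + (n + n') * N"
      using e(1) e'(1) by (simp add: algebra_simps)
    then have "P (m * v) = P (m * u + (e + e'))" by (simp add: per)
    \<comment> \<open>As x and y have different absolute values, the sum vanishes only if the second
      arc undoes the first, which \<open>u \<noteq> v\<close> forbids.\<close>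
    moreover have "\<bar>e + e'\<bar> \<in> {1..4}"
      using e(2) e'(2) xy \<open>u \<noteq> v\<close> unfolding atLeastAtMost_iff by (elim disjE conjE) linarith+
    ultimately show ?thesis using far[OF one] by simp
  qed
  have sep_S: "gdist (integer_distance_graph {2, t}) u v > ereal (real (S (P (m * u))))"
    if "u \<noteq> v" "P (m * u) = P (m * v)" for u v
  proof (cases "P (m * u) = 1")
    case True
    then show ?thesis
      using that arc[of v u] gdist_le_1_iff[OF wf, of u v] S(1)
      by (auto simp: adj not_le[symmetric])
  next
    case False
    then have "S (P (m * u)) = 2" using sep(1)[of "m * u"] S(2) by simp
    then show ?thesis
      using that arc[of v u] two_arcs[of _ u v, OF _ _ that(1) False]
        gdist_le_2_iff[OF wf, of u v]
      by (auto simp: adj not_le[symmetric])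
  qed
  show ?thesis
    unfolding S_packing_coloring_def P_def[symmetric] using sep(1) by (auto intro: sep_S)
qed

section \<open>Choice of the length and the multiplier\<close>

lemma ex_S_packing_5_coloring:
  fixes t :: int
  assumes t: "odd t" "t > 3" and S: "S 1 = 1" "\<And>i. i \<ge> 2 \<Longrightarrow> S i = 2"
  shows "\<exists>f. S_packing_coloring S 5 (integer_distance_graph {2, t}) f"
proof -
  have odd_length: ?thesis
    if N: "N = t + 4 \<or> N = t - 4" "N > 0" "N mod 5 \<le> N div 5" for N
  proof -
    \<comment> \<open>Each long block contributes one letter beyond a multiple of 5, so
      \<open>N mod 5\<close> of them absorb the remainder.\<close>
    define a b where "a = N div 5 - N mod 5" and "b = N mod 5"
    have ab: "N = 5 * a + 6 * b" "a \<ge> 0" "b \<ge> 0"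
      using N(3) mult_div_mod_eq[of 5 N] unfolding a_def b_def by simp_all
    then have "a + b > 0" using N(2) by linarith
    note ab = ab this
    have "odd N" using N(1) t(1) by auto
    then obtain h where h: "N = 2 * h + 1" by (rule oddE)
    define m where "m = h + 1"
    have m: "m * 2 = 1 + 1 * N" by (simp add: m_def h)
    \<comment> \<open>Modulo \<open>N\<close>, t is -4 or 4 and \<open>2 * m\<close> is 1, so
      \<open>m * t\<close> is -2 or 2.\<close>
    have "m * t = -2 + (m - 2) * N \<or> m * t = 2 + (m + 2) * N"
    proof -
      have "m * (N - 4) = m * N - 2 * (m * 2)" "m * (N + 4) = m * N + 2 * (m * 2)"
        by (simp_all add: algebra_simps)
      moreover have "t = N - 4 \<or> t = N + 4" using N(1) by auto
      ultimately show ?thesis unfolding m by (auto simp: algebra_simps)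
    qed
    then show ?thesis
    proof
      assume "m * t = -2 + (m - 2) * N"
      with t(2) show ?thesis
        using S_packing_coloring_block_word[of t S a b N m 1 1 "-2" "m - 2"] S ab m by auto
    next
      assume "m * t = 2 + (m + 2) * N"
      with t(2) show ?thesis
        using S_packing_coloring_block_word[of t S a b N m 1 1 2 "m + 2"] S ab m by auto
    qed
  qed
  consider "t = 5" | "t = 9 \<or> t = 15" | "(t + 4) mod 5 \<le> (t + 4) div 5"
  \<comment> \<open>From 20 on the quotient by 5 is at least 4, which bounds every remainder. Below
    20 only the lengths 9, 13 and 19 fail; for the last two, \<open>t - 4\<close> is 5 or
    11.\<close>
  proof (cases "t + 4 < 20")
    case True
    from t(1) obtain h where h: "t = 2 * h + 1" by (rule oddE)
    with True t(2) have "h = 2 \<or> h = 3 \<or> h = 4 \<or> h = 5 \<or> h = 6 \<or> h = 7" by arith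
    then show ?thesis using that h by (elim disjE) simp_all
  next
    case False
    then have "(t + 4) mod 5 \<le> (t + 4) div 5"
      using mult_div_mod_eq[of 5 "t + 4"] pos_mod_bound[of 5 "t + 4"] by linarith
    then show ?thesis by (rule that(3))
  qed
  then show ?thesis
  proof cases
    case 1
    \<comment> \<open>The word is the single block \<open>231451\<close>, and 5 is -1 modulo
      6.\<close>
    with S_packing_coloring_block_word[of t S 0 1 6 1 2 0 "-1" 1] S show ?thesis by auto
  next
    case 2
    with odd_length[of "t - 4"] show ?thesis by auto
  next
    case 3
    with odd_length[of "t + 4"] t(2) show ?thesis by auto
  qed
qed

theorem theorem4:
  fixes t :: int and S :: "nat \<Rightarrow> nat"
  assumes "odd t" and "t > 3"
    and "S 1 = 1" and "\<And>i. i \<ge> 2 \<Longrightarrow> S i = 2"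
  shows "S_packing_chromatic_number S (integer_distance_graph {2, t}) = 5"
proof (rule antisym)
  show "S_packing_chromatic_number S (integer_distance_graph {2, t}) \<le> 5"
    using ex_S_packing_5_coloring[of t S] assms unfolding S_packing_chromatic_number_def
    by (intro INF_lower2[of 5]) (auto simp: numeral_eq_enat)
  have "5 \<le> k" if "S_packing_coloring S k (integer_distance_graph {2, t}) f" for k f
    using S_packing_coloring_ge_5[OF assms(1) _ assms(3,4) that] assms(2) by simp
  then show "5 \<le> S_packing_chromatic_number S (integer_distance_graph {2, t})"
    unfolding S_packing_chromatic_number_def
    by (intro INF_greatest) (auto simp: numeral_eq_enat)
qed

end
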